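(* Let $\Phi=(\phi_n)$, $\Psi=(\psi_n)$ be sequences in $\mathcal H$ and $m=(m_n)$ a complex scalar sequence, and let $M_{m,\Phi,\Psi}$ be unconditionally convergent on $\mathcal H$. (i) Then $(|m_n|\cdot\|\phi_n\|\cdot\psi_n)$ and $(|m_n|\cdot\|\psi_n\|\cdot\phi_n)$ are Bessel for $\mathcal H$. As a consequence, the sequence $(|m_n|\cdot\|\phi_n\|\cdot\|\psi_n\|)$ is bounded. (ii) If $\Phi$ (resp. $m\Phi$) is $NBB$, then $m\Psi$ (resp. $\Psi$) is a Bessel sequence for $\mathcal H$. (iii) If $\Psi$ (resp. $m\Psi$) is $NBB$, then $m\Phi$ (resp. $\Phi$) is a Bessel sequence for $\mathcal H$. (iv) If both $\Phi$ and $\Psi$ are $NBB$, then $m\in\ell^\infty$. (v) If $\Phi$, $\Psi$ and $m$ are $NBB$, then $m$ is $SN$ and both $\Phi$ and $\Psi$ are Bessel sequences for $\mathcal H$.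
   Context: $\mathcal H$ is a separable infinite-dimensional complex Hilbert space, inner product linear in the first argument; all sequences are indexed by $\mathbb N$. The multiplier is $M_{m,\Phi,\Psi}f=\sum_n m_n\langle f,\psi_n\rangle\phi_n$; it is unconditionally convergent on $\mathcal H$ if this series converges unconditionally (i.e. every permutation of it converges) for every $f\in\mathcal H$. Notation: $m\Phi=(m_n\phi_n)$. A sequence $\Phi$ is Bessel for $\mathcal H$ if there is $B>0$ with $\sum|\langle h,\phi_n\rangle|^2\le B\|h\|^2$ for all $h\in\mathcal H$. $\Phi$ is $NBB$ (norm-bounded below) if $\inf_n\|\phi_n\|>0$; a scalar sequence $m$ is $NBB$ if $\inf_n|m_n|>0$ and $SN$ (semi-normalized) if $0<a\le|m_n|\le b<\infty$ for all $n$, for some constants $a,b$. *)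

theory Defs
  imports "HOL-Analysis.Analysis"
begin

text \<open>
  Complex inner product spaces, modelled on the library class \<open>real_inner\<close>. The inner product is
  linear in the first argument. \<open>scaleR_scaleC\<close> makes the real structure of
  \<open>real_normed_vector\<close> the restriction of the complex one, and the topology is that of the norm
  induced by the inner product.
\<close>

class complex_inner = real_normed_vector +
  fixes scaleC :: "complex \<Rightarrow> 'a \<Rightarrow> 'a" (infixr \<open>*\<^sub>C\<close> 75)
    and cinner :: "'a \<Rightarrow> 'a \<Rightarrow> complex"
  assumes scaleC_add_right: "c *\<^sub>C (x + y) = c *\<^sub>C x + c *\<^sub>C y"
    and scaleC_add_left: "(c + d) *\<^sub>C x = c *\<^sub>C x + d *\<^sub>C x"
    and scaleC_scaleC: "c *\<^sub>C (d *\<^sub>C x) = (c * d) *\<^sub>C x"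
    and scaleC_one: "1 *\<^sub>C x = x"
    and scaleR_scaleC: "r *\<^sub>R x = complex_of_real r *\<^sub>C x"
    and cinner_commute: "cinner x y = cnj (cinner y x)"
    and cinner_add_left: "cinner (x + y) z = cinner x z + cinner y z"
    and cinner_scaleC_left: "cinner (c *\<^sub>C x) y = c * cinner x y"
    and cinner_ge_zero: "0 \<le> Re (cinner x x)"
    and cinner_eq_zero_iff: "cinner x x = 0 \<longleftrightarrow> x = 0"
    and norm_eq_sqrt_cinner: "norm x = sqrt (Re (cinner x x))"

class complex_hilbert = complex_inner + complete_space

interpretation complex_vector:
  vector_space "scaleC :: complex \<Rightarrow> 'a \<Rightarrow> 'a :: complex_inner"
  by unfold_locales
    (simp_all add: scaleC_add_right scaleC_add_left scaleC_scaleC scaleC_one)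

definition unconditionally_convergent :: "(nat \<Rightarrow> 'a :: real_normed_vector) \<Rightarrow> bool" where
  "unconditionally_convergent x \<longleftrightarrow> (\<forall>\<pi>. bij \<pi> \<longrightarrow> summable (\<lambda>n. x (\<pi> n)))"

definition multiplier_term ::
  "(nat \<Rightarrow> complex) \<Rightarrow> (nat \<Rightarrow> 'a) \<Rightarrow> (nat \<Rightarrow> 'a) \<Rightarrow> 'a \<Rightarrow> nat \<Rightarrow> 'a :: complex_inner" where
  "multiplier_term m \<Phi> \<Psi> f n = (m n * cinner f (\<Psi> n)) *\<^sub>C \<Phi> n"

definition multiplier_uncond_convergent ::
  "(nat \<Rightarrow> complex) \<Rightarrow> (nat \<Rightarrow> 'a :: complex_inner) \<Rightarrow> (nat \<Rightarrow> 'a) \<Rightarrow> bool" where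
  "multiplier_uncond_convergent m \<Phi> \<Psi> \<longleftrightarrow>
     (\<forall>f. unconditionally_convergent (multiplier_term m \<Phi> \<Psi> f))"

text \<open>
  Summability is required explicitly because \<open>suminf\<close> of a divergent series is unspecified.
\<close>

definition Bessel :: "(nat \<Rightarrow> 'a :: complex_inner) \<Rightarrow> bool" where
  "Bessel \<Phi> \<longleftrightarrow> (\<exists>B>0. \<forall>h. summable (\<lambda>n. (cmod (cinner h (\<Phi> n)))\<^sup>2) \<and>
     (\<Sum>n. (cmod (cinner h (\<Phi> n)))\<^sup>2) \<le> B * (norm h)\<^sup>2)"

text \<open>\<open>NBB\<close> serves both for sequences of vectors and, at type \<open>complex\<close>, for scalar sequences.\<close>

definition NBB :: "(nat \<Rightarrow> 'a :: real_normed_vector) \<Rightarrow> bool" where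
  "NBB \<Phi> \<longleftrightarrow> (INF n. norm (\<Phi> n)) > 0"

definition SN :: "(nat \<Rightarrow> complex) \<Rightarrow> bool" where
  "SN m \<longleftrightarrow> (\<exists>a b. 0 < a \<and> (\<forall>n. a \<le> cmod (m n) \<and> cmod (m n) \<le> b))"

end

theory Submission
  imports Defs
begin

text \<open>
  Unconditional convergence bounds the finite subsums of each series
  \<open>\<Sum>n. m n * \<langle>f, \<Psi> n\<rangle> \<Phi> n\<close>, so by Banach--Steinhaus the finite-rank operators given by these
  subsums are uniformly bounded by some \<open>C\<close>, and so are their adjoints, which are the subsums of the
  multiplier with \<open>\<Phi>\<close> and \<open>\<Psi>\<close> exchanged and \<open>m\<close> conjugated. In a Hilbert space one can choose
  signs such that the norm square of a signed sum dominates the sum of the norm squares, and a signed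
  sum is a difference of two subsums. This bounds \<open>\<Sum>n. \<bar>m n\<bar>\<^sup>2 \<bar>\<langle>f, \<Psi> n\<rangle>\<bar>\<^sup>2 \<parallel>\<Phi> n\<parallel>\<^sup>2\<close> by
  \<open>(2 C \<parallel>f\<parallel>)\<^sup>2\<close> and gives (i), from which the other parts follow by comparison.
\<close>

section \<open>Elementary identities in complex inner product spaces and the Cauchy--Schwarz
  inequality\<close>

lemma cinner_add_right: "cinner x (y + z) = cinner x y + cinner x z" for x :: "'a :: complex_inner"
  by (metis cinner_add_left cinner_commute complex_cnj_add)

lemma cinner_scaleC_right: "cinner x (c *\<^sub>C y) = cnj c * cinner x y" for x :: "'a :: complex_inner"
  by (metis cinner_scaleC_left cinner_commute complex_cnj_mult)

lemma cinner_scaleR_left: "cinner (r *\<^sub>R x) y = of_real r * cinner x y"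
  for x :: "'a :: complex_inner"
  by (simp add: scaleR_scaleC cinner_scaleC_left)

lemma cinner_scaleR_right: "cinner x (r *\<^sub>R y) = of_real r * cinner x y"
  for x :: "'a :: complex_inner"
  by (simp add: scaleR_scaleC cinner_scaleC_right)

lemma cinner_zero_left: "cinner 0 y = 0" for y :: "'a :: complex_inner"
  using cinner_scaleR_left[of 0 0 y] by simp

lemma cinner_zero_right: "cinner x 0 = 0" for x :: "'a :: complex_inner"
  using cinner_scaleR_right[of x 0 0] by simp

lemma cinner_sum_left: "cinner (\<Sum>i\<in>A. f i) y = (\<Sum>i\<in>A. cinner (f i) y)"
  for y :: "'a :: complex_inner"
  by (induction A rule: infinite_finite_induct) (simp_all add: cinner_zero_left cinner_add_left)

lemma cinner_sum_right: "cinner x (\<Sum>i\<in>A. f i) = (\<Sum>i\<in>A. cinner x (f i))"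
  for x :: "'a :: complex_inner"
  by (induction A rule: infinite_finite_induct) (simp_all add: cinner_zero_right cinner_add_right)

lemma cinner_self: "cinner x x = of_real ((norm x)\<^sup>2)" for x :: "'a :: complex_inner"
proof -
  have "Im (cinner x x) = 0"
    using cinner_commute[of x x] by (simp add: complex_eq_iff)
  then show ?thesis
    by (simp add: complex_eq_iff norm_eq_sqrt_cinner cinner_ge_zero del: of_real_power)
qed

lemma norm_scaleC: "norm (c *\<^sub>C x) = cmod c * norm x" for x :: "'a :: complex_inner"
proof -
  have "cinner (c *\<^sub>C x) (c *\<^sub>C x) = (c * cnj c) * cinner x x"
    by (simp add: cinner_scaleC_left cinner_scaleC_right)
  also have "\<dots> = of_real ((cmod c)\<^sup>2 * (norm x)\<^sup>2)"
    unfolding cinner_self of_real_mult complex_norm_square ..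
  finally have "cinner (c *\<^sub>C x) (c *\<^sub>C x) = of_real ((cmod c)\<^sup>2 * (norm x)\<^sup>2)" .
  then have "of_real ((norm (c *\<^sub>C x))\<^sup>2) = (of_real ((cmod c * norm x)\<^sup>2) :: complex)"
    unfolding cinner_self power_mult_distrib .
  then have "(norm (c *\<^sub>C x))\<^sup>2 = (cmod c * norm x)\<^sup>2"
    using of_real_eq_iff by blast
  then show ?thesis
    by (simp add: power2_eq_iff_nonneg)
qed

lemma norm_add_square: "(norm (x + y))\<^sup>2 = (norm x)\<^sup>2 + (norm y)\<^sup>2 + 2 * Re (cinner x y)"
  for x :: "'a :: complex_inner"
proof -
  have "of_real ((norm (x + y))\<^sup>2) = cinner x x + cinner y y + (cinner x y + cnj (cinner x y))"
    unfolding cinner_self[symmetric] cinner_add_left cinner_add_right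
    using cinner_commute[of y x] by (simp add: algebra_simps)
  also have "\<dots> = of_real ((norm x)\<^sup>2 + (norm y)\<^sup>2 + 2 * Re (cinner x y))"
    by (simp add: cinner_self complex_add_cnj)
  finally show ?thesis
    using of_real_eq_iff by blast
qed

text \<open>The triangle inequality is a class axiom here, so Cauchy--Schwarz is read off from it.\<close>

lemma Re_cinner_le: "Re (cinner x y) \<le> norm x * norm y" for x :: "'a :: complex_inner"
proof -
  have "(norm (x + y))\<^sup>2 \<le> (norm x + norm y)\<^sup>2"
    by (intro power_mono norm_triangle_ineq norm_ge_zero)
  then show ?thesis
    unfolding norm_add_square by (simp add: power2_sum)
qed

lemma cmod_cinner_le: "cmod (cinner x y) \<le> norm x * norm y" for x :: "'a :: complex_inner"
proof (cases "cinner x y = 0")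
  case False
  \<comment> \<open>A scalar of modulus 1 that rotates the inner product onto the nonnegative real
    axis, so that the bound on real parts becomes a bound on the modulus.\<close>
  define c where "c = cnj (sgn (cinner x y))"
  have "cmod (cinner x y) = Re (cinner (c *\<^sub>C x) y)"
  proof -
    have "cinner (c *\<^sub>C x) y = (cinner x y * cnj (cinner x y)) / of_real (cmod (cinner x y))"
      by (simp add: c_def cinner_scaleC_left sgn_eq)
    also have "\<dots> = of_real (cmod (cinner x y))"
      unfolding complex_norm_square[symmetric] by (simp add: power2_eq_square)
    finally have "cinner (c *\<^sub>C x) y = of_real (cmod (cinner x y))" .
    then show ?thesis by simp
  qed
  also have "\<dots> \<le> norm (c *\<^sub>C x) * norm y"
    by (rule Re_cinner_le)
  also have "\<dots> = norm x * norm y"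
    using False by (simp add: norm_scaleC c_def norm_sgn)
  finally show ?thesis .
qed simp

section \<open>Sums of norm squares against signed sums\<close>

text \<open>The signs are chosen greedily: each new vector gets the sign that makes its cross term
  with the signed sum \<open>s\<close> so far nonnegative, so \<open>norm_add_square\<close> loses
  nothing. \<open>P\<close> collects the indices with sign plus.\<close>

lemma exists_signs_sum_squares_le:
  fixes x :: "'i \<Rightarrow> 'a :: complex_inner"
  assumes "finite F"
  shows "\<exists>P \<subseteq> F. (\<Sum>i\<in>F. (norm (x i))\<^sup>2) \<le> (norm ((\<Sum>i\<in>P. x i) - (\<Sum>i\<in>F - P. x i)))\<^sup>2"
  using assms
proof induction
  case (insert j F)
  then obtain P where P: "P \<subseteq> F"
    "(\<Sum>i\<in>F. (norm (x i))\<^sup>2) \<le> (norm ((\<Sum>i\<in>P. x i) - (\<Sum>i\<in>F - P. x i)))\<^sup>2"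
    by blast
  define s where "s = (\<Sum>i\<in>P. x i) - (\<Sum>i\<in>F - P. x i)"
  have fin: "finite P" "finite (F - P)" "j \<notin> P" "j \<notin> F"
    using P insert.hyps finite_subset by auto
  show ?case
  proof (cases "Re (cinner s (x j)) \<ge> 0")
    case True
    have "insert j F - insert j P = F - P"
      using fin by auto
    then have "(\<Sum>i\<in>insert j P. x i) - (\<Sum>i\<in>insert j F - insert j P. x i) = s + x j"
      using fin by (simp add: s_def)
    moreover have "(\<Sum>i\<in>insert j F. (norm (x i))\<^sup>2) \<le> (norm (s + x j))\<^sup>2"
      using True P insert.hyps by (simp add: norm_add_square s_def)
    ultimately show ?thesis
      using P(1) by (intro exI[of _ "insert j P"]) auto
  next
    case False
    have "insert j F - P = insert j (F - P)"
      using fin by auto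
    \<comment> \<open>The minus sign is written as a scalar so that \<open>norm_add_square\<close>
      and \<open>cinner_scaleR_right\<close> apply.\<close>
    then have "(\<Sum>i\<in>P. x i) - (\<Sum>i\<in>insert j F - P. x i) = s + (-1) *\<^sub>R x j"
      using fin by (simp add: s_def)
    moreover have "(\<Sum>i\<in>insert j F. (norm (x i))\<^sup>2) \<le> (norm (s + (-1) *\<^sub>R x j))\<^sup>2"
      using False P insert.hyps unfolding norm_add_square cinner_scaleR_right by (simp add: s_def)
    ultimately show ?thesis
      using P(1) by (intro exI[of _ P]) auto
  qed
qed simp

lemma sum_squares_le_of_subset_sums_le:
  fixes x :: "'i \<Rightarrow> 'a :: complex_inner"
  assumes "finite F" and "\<And>P. P \<subseteq> F \<Longrightarrow> norm (\<Sum>i\<in>P. x i) \<le> C"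
  shows "(\<Sum>i\<in>F. (norm (x i))\<^sup>2) \<le> (2 * C)\<^sup>2"
proof -
  obtain P where P: "P \<subseteq> F"
    "(\<Sum>i\<in>F. (norm (x i))\<^sup>2) \<le> (norm ((\<Sum>i\<in>P. x i) - (\<Sum>i\<in>F - P. x i)))\<^sup>2"
    using exists_signs_sum_squares_le[OF assms(1)] by blast
  have "norm ((\<Sum>i\<in>P. x i) - (\<Sum>i\<in>F - P. x i)) \<le> 2 * C"
    using norm_triangle_ineq4[of "\<Sum>i\<in>P. x i" "\<Sum>i\<in>F - P. x i"] assms(2)[OF P(1)]
      assms(2)[of "F - P"] by auto
  then have "(norm ((\<Sum>i\<in>P. x i) - (\<Sum>i\<in>F - P. x i)))\<^sup>2 \<le> (2 * C)\<^sup>2"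
    by (intro power_mono) auto
  with P(2) show ?thesis by linarith
qed

section \<open>Unconditional convergence and bounded finite subsums\<close>

text \<open>The permutation is the limit of a growing list. Stage \<open>k\<close> appends the block
  \<open>F K\<close>, where \<open>K\<close> is the set of entries so far, and then \<open>k\<close>
  if it is still missing. Disjointness from \<open>K\<close> keeps the entries distinct, the added
  \<open>k\<close> gives surjectivity, and nonempty blocks make the lists grow without end. Blocks
  beyond every \<open>N\<close> are what a contradiction to the Cauchy criterion requires.\<close>

lemma exists_bij_contiguous_blocks:
  assumes "\<And>K :: nat set. finite K \<Longrightarrow> finite (F K) \<and> F K \<noteq> {} \<and> F K \<inter> K = {}"
  shows "\<exists>\<pi> :: nat \<Rightarrow> nat. bij \<pi> \<and> (\<forall>N. \<exists>a\<ge>N. \<exists>b K. finite K \<and> \<pi> ` {a..<b} = F K)"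
proof -
  define step where "step k L = (let L' = L @ sorted_list_of_set (F (set L))
      in if k \<in> set L' then L' else L' @ [k])" for k L
  define L where "L = rec_nat [] step"
  have L0: "L 0 = []" and LS: "L (Suc k) = step k (L k)" for k
    by (simp_all add: L_def)
  have dist: "distinct (L k)" for k
    using assms[of "set (L _)"] by (induction k) (auto simp: L0 LS step_def Let_def)
  have pre: "\<exists>M. L (Suc k) = (L k @ sorted_list_of_set (F (set (L k)))) @ M" for k
    by (simp add: LS step_def Let_def)
  have mem: "k \<in> set (L (Suc k))" for k
    by (simp add: LS step_def Let_def)
  have nth_Suc: "L (Suc k) ! n = L k ! n" if "n < length (L k)" for k n
    using pre[of k] that by (auto simp: nth_append)
  have len_Suc: "length (L k) < length (L (Suc k))" for k
  proof -
    have "length (sorted_list_of_set (F (set (L k)))) > 0"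
      using assms[of "set (L k)"] by (simp add: card_gt_0_iff)
    moreover obtain M where "L (Suc k) = (L k @ sorted_list_of_set (F (set (L k)))) @ M"
      using pre by blast
    ultimately show ?thesis by simp
  qed
  have len_mono: "length (L j) \<le> length (L k)" if "j \<le> k" for j k
    using len_Suc less_imp_le lift_Suc_mono_le[of "\<lambda>k. length (L k)"] that by blast
  have len: "k \<le> length (L k)" for k
    using len_Suc by (induction k) (auto simp: L0 Suc_le_eq intro: le_less_trans)
  have nth_mono: "L k ! n = L j ! n" if "j \<le> k" "n < length (L j)" for j k n
    using that
    by (induction k rule: dec_induct) (use nth_Suc len_mono less_le_trans in \<open>metis+\<close>)
  \<comment> \<open>Stage \<open>Suc n\<close> is the first whose length is guaranteed to exceed
    \<open>n\<close>; later stages only extend the list, so any stage that is long enough yields the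
    same value.\<close>
  define \<pi> where "\<pi> n = L (Suc n) ! n" for n
  have \<pi>: "\<pi> n = L k ! n" if "n < length (L k)" for n k
    using nth_mono[of k "Suc n" n] nth_mono[of "Suc n" k n] len[of "Suc n"] that
    unfolding \<pi>_def by (metis Suc_le_lessD nle_le)
  have "inj \<pi>"
  proof (rule injI)
    fix i j assume eq: "\<pi> i = \<pi> j"
    have "i < length (L (Suc (max i j)))" "j < length (L (Suc (max i j)))"
      using len[of "Suc (max i j)"] by auto
    then show "i = j"
      using eq dist \<pi> nth_eq_iff_index_eq by metis
  qed
  moreover have "surj \<pi>"
    unfolding surj_def using mem \<pi> by (metis in_set_conv_nth)
  moreover have "\<exists>a\<ge>N. \<exists>b K. finite K \<and> \<pi> ` {a..<b} = F K" for N
  proof -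
    \<comment> \<open>The block appended at stage \<open>N\<close> starts at position
      \<open>length (L N)\<close>, which is at least \<open>N\<close>.\<close>
    define S where "S = sorted_list_of_set (F (set (L N)))"
    define a where "a = length (L N)"
    obtain M where M: "L (Suc N) = (L N @ S) @ M"
      using pre[of N] S_def by auto
    have "\<pi> ` {a..<a + length S} = (\<lambda>i. \<pi> (i + a)) ` {0..<length S}"
      unfolding image_image[symmetric, of \<pi> "\<lambda>i. i + a"] image_add_atLeastLessThan'
      by (simp add: add.commute)
    also have "\<dots> = (!) S ` {0..<length S}"
    proof (rule image_cong)
      fix i assume "i \<in> {0..<length S}"
      then show "\<pi> (i + a) = S ! i"
        using \<pi>[of "i + a" "Suc N"] M by (simp add: a_def nth_append)
    qed simp
    also have "\<dots> = set S"
      by (auto simp: set_conv_nth)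
    also have "\<dots> = F (set (L N))"
      using assms[of "set (L N)"] by (simp add: S_def)
    finally show ?thesis
      using len[of N] unfolding a_def by blast
  qed
  ultimately show ?thesis
    unfolding bij_def by blast
qed

text \<open>If the subsums were unbounded, every finite set would have a finite set disjoint from it
  with sum of norm above 1. A permutation that lists such sets as contiguous blocks arbitrarily far
  out has partial sums that are not Cauchy.\<close>

lemma unconditionally_convergent_bounded_sums:
  fixes x :: "nat \<Rightarrow> 'a :: real_normed_vector"
  assumes "unconditionally_convergent x"
  shows "\<exists>C. \<forall>F. finite F \<longrightarrow> norm (\<Sum>i\<in>F. x i) \<le> C"
proof (rule ccontr)
  assume neg: "\<nexists>C. \<forall>F. finite F \<longrightarrow> norm (\<Sum>i\<in>F. x i) \<le> C"
  have "\<exists>F. finite F \<and> F \<inter> K = {} \<and> norm (\<Sum>i\<in>F. x i) > 1" if K: "finite K" for K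
  proof -
    \<comment> \<open>\<open>D\<close> bounds every subsum inside \<open>K\<close>, so a sum of norm
      above \<open>1 + D\<close> still exceeds 1 after the indices in \<open>K\<close> are
      removed.\<close>
    define D where "D = (\<Sum>i\<in>K. norm (x i))"
    obtain F where F: "finite F" "norm (\<Sum>i\<in>F. x i) > 1 + D"
      using neg by (meson not_le)
    have "norm (\<Sum>i\<in>F \<inter> K. x i) \<le> D"
      unfolding D_def using K
      by (intro order_trans[OF norm_sum] sum_mono2) auto
    moreover have "(\<Sum>i\<in>F. x i) = (\<Sum>i\<in>F \<inter> K. x i) + (\<Sum>i\<in>F - K. x i)"
      using F(1) by (rule sum.Int_Diff)
    ultimately have "norm (\<Sum>i\<in>F - K. x i) > 1"
      using F(2) norm_triangle_ineq[of "\<Sum>i\<in>F \<inter> K. x i" "\<Sum>i\<in>F - K. x i"] by simp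
    then show ?thesis
      using F(1) by (intro exI[of _ "F - K"]) auto
  qed
  then obtain F where F: "\<And>K. finite K \<Longrightarrow> finite (F K) \<and> F K \<inter> K = {} \<and> norm (\<Sum>i\<in>F K. x i) > 1"
    by metis
  have ne: "F K \<noteq> {}" if "finite K" for K
    using F[OF that] by auto
  obtain \<pi> :: "nat \<Rightarrow> nat" where \<pi>: "bij \<pi>" "\<And>N. \<exists>a\<ge>N. \<exists>b K. finite K \<and> \<pi> ` {a..<b} = F K"
    using exists_bij_contiguous_blocks[of F] F ne by metis
  have "Cauchy (\<lambda>n. \<Sum>i<n. x (\<pi> i))"
    using assms \<pi>(1) unfolding unconditionally_convergent_def summable_iff_convergent
    by (blast intro: convergent_Cauchy)
  then obtain N where N: "\<And>a b. a \<ge> N \<Longrightarrow> b \<ge> N \<Longrightarrow>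
      dist (\<Sum>i<a. x (\<pi> i)) (\<Sum>i<b. x (\<pi> i)) < 1"
    unfolding Cauchy_def by (meson zero_less_one)
  obtain a b K where K: "a \<ge> N" "finite K" "\<pi> ` {a..<b} = F K"
    using \<pi>(2)[of N] by blast
  have "a \<le> b"
    using K(3) ne[OF K(2)] by (cases "a \<le> b") auto
  have "(\<Sum>i\<in>F K. x i) = (\<Sum>i\<in>{a..<b}. x (\<pi> i))"
    unfolding K(3)[symmetric] using \<pi>(1)
    by (subst sum.reindex) (auto simp: bij_def intro: inj_on_subset)
  also have "\<dots> = (\<Sum>i<b. x (\<pi> i)) - (\<Sum>i<a. x (\<pi> i))"
    using sum_diff_nat_ivl[of 0 a b "\<lambda>i. x (\<pi> i)"] \<open>a \<le> b\<close> by (simp add: lessThan_atLeast0)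
  finally have "norm (\<Sum>i\<in>F K. x i) < 1"
    using N[of b a] K(1) \<open>a \<le> b\<close> by (simp add: dist_norm)
  then show False
    using F[OF K(2)] by simp
qed

section \<open>The uniform boundedness principle\<close>

text \<open>By Baire, one of the closed sets \<open>E k\<close> on which all operators are bounded
  by \<open>k\<close> has an interior point; linearity carries the bound from a ball there to the
  whole space.\<close>

theorem Banach_Steinhaus:
  fixes T :: "'i \<Rightarrow> 'a :: banach \<Rightarrow> 'b :: real_normed_vector"
  assumes lin: "\<And>i. i \<in> I \<Longrightarrow> bounded_linear (T i)"
    and ptw: "\<And>x. \<exists>C. \<forall>i\<in>I. norm (T i x) \<le> C"
  shows "\<exists>C\<ge>0. \<forall>i\<in>I. \<forall>x. norm (T i x) \<le> C * norm x"
proof -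
  define E where "E k = {x. \<forall>i\<in>I. norm (T i x) \<le> real k}" for k
  have "closed (E k)" for k
  proof -
    have "E k = (\<Inter>i\<in>I. {x. norm (T i x) \<le> real k})"
      by (auto simp: E_def)
    moreover have "closed {x. norm (T i x) \<le> real k}" if "i \<in> I" for i
      using lin[OF that]
      by (intro closed_Collect_le continuous_intros linear_continuous_on)
    ultimately show ?thesis by auto
  qed
  moreover have "(\<Union>k. E k) = UNIV"
  proof -
    have "\<exists>k. x \<in> E k" for x
    proof -
      obtain C where "\<forall>i\<in>I. norm (T i x) \<le> C"
        using ptw by blast
      moreover obtain k where "C \<le> real k"
        using real_arch_simple by blast
      ultimately have "x \<in> E k"
        by (auto simp: E_def intro: order_trans)
      then show ?thesis ..
    qed
    then show ?thesis by blast
  qed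
  moreover have "Met_TC.mcomplete TYPE('a)"
    by (simp add: mcomplete_iff_complete complete_UNIV)
  ultimately have "\<exists>k. interior (E k) \<noteq> {}"
    using Met_TC.metric_Baire_category_alt[of "range E"] by fastforce
  then obtain k x0 where "x0 \<in> interior (E k)"
    by blast
  then obtain r where r: "r > 0" "cball x0 r \<subseteq> E k"
    by (meson mem_interior_cball)
  \<comment> \<open>Rescaled to norm \<open>r\<close>, \<open>x\<close> is the difference of two
    points of the closed ball around \<open>x0\<close>, both with images of norm at most
    \<open>k\<close>; hence \<open>2 * real k\<close>, and division by \<open>r\<close> undoes the
    scaling.\<close>
  have "norm (T i x) \<le> 2 * real k / r * norm x" if i: "i \<in> I" for i x
  proof (cases "x = 0")
    case True
    then show ?thesis
      using lin[OF i] by (simp add: linear_simps)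
  next
    case False
    interpret bounded_linear "T i" by (rule lin[OF i])
    define c where "c = r / norm x"
    have c: "c > 0" "norm (c *\<^sub>R x) = r"
      using False r by (auto simp: c_def)
    have "x0 + c *\<^sub>R x \<in> E k" "x0 \<in> E k"
      using r c by (auto simp: dist_norm intro!: subsetD[OF r(2)])
    then have "norm (T i (x0 + c *\<^sub>R x)) \<le> k" "norm (T i x0) \<le> k"
      using i by (auto simp: E_def)
    then have "norm (T i (x0 + c *\<^sub>R x) - T i x0) \<le> 2 * real k"
      using norm_triangle_ineq4[of "T i (x0 + c *\<^sub>R x)" "T i x0"] by linarith
    then have "c * norm (T i x) \<le> 2 * real k"
      using c by (simp add: add scaleR)
    then show ?thesis
      using False r by (simp add: c_def field_simps)
  qed
  then show ?thesis
    using r by (intro exI[of _ "2 * real k / r"]) auto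
qed

instance complex_hilbert \<subseteq> banach ..

section \<open>Finite subsums of a multiplier and their adjoints\<close>

lemma bounded_linear_multiplier_sum:
  "bounded_linear (\<lambda>f. \<Sum>n\<in>F. multiplier_term m \<Phi> \<Psi> f n)"
proof (rule bounded_linear_sum)
  fix n
  show "bounded_linear (\<lambda>f. multiplier_term m \<Phi> \<Psi> f n)"
  proof (rule bounded_linear_intro[where K = "cmod (m n) * norm (\<Psi> n) * norm (\<Phi> n)"])
    fix f g :: 'a and r :: real
    show "multiplier_term m \<Phi> \<Psi> (f + g) n = multiplier_term m \<Phi> \<Psi> f n + multiplier_term m \<Phi> \<Psi> g n"
      by (simp add: multiplier_term_def cinner_add_left scaleC_add_left ring_distribs)
    show "multiplier_term m \<Phi> \<Psi> (r *\<^sub>R f) n = r *\<^sub>R multiplier_term m \<Phi> \<Psi> f n"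
      by (simp add: multiplier_term_def cinner_scaleR_left scaleR_scaleC[of r "_ *\<^sub>C _"] scaleC_scaleC mult_ac)
    show "norm (multiplier_term m \<Phi> \<Psi> f n) \<le> norm f * (cmod (m n) * norm (\<Psi> n) * norm (\<Phi> n))"
      using mult_left_mono[OF cmod_cinner_le[of f "\<Psi> n"], of "cmod (m n) * norm (\<Phi> n)"]
      by (simp add: multiplier_term_def norm_scaleC norm_mult mult_ac)
  qed
qed

text \<open>Termwise this is the adjoint of a rank-one operator: the two vectors trade places, and
  the scalar is conjugated because the inner product is conjugate-linear in its second
  argument.\<close>

lemma cinner_multiplier_sum:
  "cinner (\<Sum>n\<in>F. multiplier_term m \<Phi> \<Psi> f n) g
    = cinner f (\<Sum>n\<in>F. multiplier_term (\<lambda>n. cnj (m n)) \<Psi> \<Phi> g n)"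
  unfolding cinner_sum_left cinner_sum_right
proof (rule sum.cong[OF refl])
  fix n
  show "cinner (multiplier_term m \<Phi> \<Psi> f n) g = cinner f (multiplier_term (\<lambda>n. cnj (m n)) \<Psi> \<Phi> g n)"
    using cinner_commute[of g "\<Phi> n"]
    by (simp add: multiplier_term_def cinner_scaleC_left cinner_scaleC_right)
qed

text \<open>An adjoint inherits the operator bound: with \<open>h\<close> the adjoint applied to
  \<open>g\<close>, moving the operator back onto \<open>h\<close> bounds the square of
  \<open>norm h\<close> by \<open>C * norm h * norm g\<close>, and one factor \<open>norm h\<close>
  cancels.\<close>

lemma norm_adjoint_multiplier_sum_le:
  assumes "\<And>f. norm (\<Sum>n\<in>F. multiplier_term m \<Phi> \<Psi> f n) \<le> C * norm f"
  shows "norm (\<Sum>n\<in>F. multiplier_term (\<lambda>n. cnj (m n)) \<Psi> \<Phi> g n) \<le> C * norm g"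
proof -
  define h where "h = (\<Sum>n\<in>F. multiplier_term (\<lambda>n. cnj (m n)) \<Psi> \<Phi> g n)"
  have "(norm h)\<^sup>2 = Re (cinner (\<Sum>n\<in>F. multiplier_term m \<Phi> \<Psi> h n) g)"
    unfolding cinner_multiplier_sum h_def[symmetric] by (simp add: cinner_self del: of_real_power)
  also have "\<dots> \<le> C * norm h * norm g"
    by (intro order_trans[OF Re_cinner_le] mult_right_mono assms norm_ge_zero)
  finally have "norm h * norm h \<le> norm h * (C * norm g)"
    by (simp add: power2_eq_square mult_ac)
  \<comment> \<open>The sign of \<open>C\<close> is not given; this settles the case
    \<open>h = 0\<close>, where cancellation is impossible.\<close>
  moreover have "0 \<le> C * norm g"
    using assms[of g] norm_ge_zero order_trans by blast
  ultimately show ?thesis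
    unfolding h_def[symmetric] by (cases "h = 0") auto
qed

section \<open>Bessel sequences through finite sums, comparison and norm bounds\<close>

lemma BesselI:
  assumes "\<And>F h. finite F \<Longrightarrow> (\<Sum>n\<in>F. (cmod (cinner h (\<Phi> n)))\<^sup>2) \<le> B * (norm h)\<^sup>2"
  shows "Bessel \<Phi>"
  unfolding Bessel_def
\<comment> \<open>The maximum with 1 supplies the positive constant that \<open>Bessel\<close>
  demands, as \<open>B\<close> may have any sign.\<close>
proof (intro exI[of _ "max B 1"] conjI allI)
  fix h
  have sm: "summable (\<lambda>n. (cmod (cinner h (\<Phi> n)))\<^sup>2)"
    by (rule summableI_nonneg_bounded) (use assms in auto)
  then show "summable (\<lambda>n. (cmod (cinner h (\<Phi> n)))\<^sup>2)" .
  have "(\<Sum>n. (cmod (cinner h (\<Phi> n)))\<^sup>2) \<le> B * (norm h)\<^sup>2"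
    by (rule suminf_le_const[OF sm]) (use assms in auto)
  also have "\<dots> \<le> max B 1 * (norm h)\<^sup>2"
    by (intro mult_right_mono) auto
  finally show "(\<Sum>n. (cmod (cinner h (\<Phi> n)))\<^sup>2) \<le> max B 1 * (norm h)\<^sup>2" .
qed auto

lemma BesselE:
  assumes "Bessel \<Phi>"
  obtains B where "B > 0"
    "\<And>F h. finite F \<Longrightarrow> (\<Sum>n\<in>F. (cmod (cinner h (\<Phi> n)))\<^sup>2) \<le> B * (norm h)\<^sup>2"
proof -
  obtain B where B: "B > 0" "\<And>h. summable (\<lambda>n. (cmod (cinner h (\<Phi> n)))\<^sup>2)"
    "\<And>h. (\<Sum>n. (cmod (cinner h (\<Phi> n)))\<^sup>2) \<le> B * (norm h)\<^sup>2"
    using assms unfolding Bessel_def by blast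
  have "(\<Sum>n\<in>F. (cmod (cinner h (\<Phi> n)))\<^sup>2) \<le> B * (norm h)\<^sup>2" if "finite F" for F h
    using sum_le_suminf[OF B(2) that, of h] B(3)[of h] by force
  with B(1) show ?thesis by (rule that)
qed

text \<open>Termwise domination up to the factor \<open>c\<close> turns a Bessel constant
  \<open>B\<close> into \<open>B / c\<^sup>2\<close>. A lower bound from \<open>NBB\<close> serves
  as \<open>c\<close> in the applications.\<close>

lemma Bessel_mono:
  assumes "Bessel \<Phi>" "c > 0" "\<And>h n. c * cmod (cinner h (\<Psi> n)) \<le> cmod (cinner h (\<Phi> n))"
  shows "Bessel \<Psi>"
proof -
  obtain B where B:
    "\<And>F h. finite F \<Longrightarrow> (\<Sum>n\<in>F. (cmod (cinner h (\<Phi> n)))\<^sup>2) \<le> B * (norm h)\<^sup>2"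
    using BesselE[OF assms(1)] by metis
  have "(\<Sum>n\<in>F. (cmod (cinner h (\<Psi> n)))\<^sup>2) \<le> (B / c\<^sup>2) * (norm h)\<^sup>2" if "finite F" for F h
  proof -
    have "c\<^sup>2 * (\<Sum>n\<in>F. (cmod (cinner h (\<Psi> n)))\<^sup>2) = (\<Sum>n\<in>F. (c * cmod (cinner h (\<Psi> n)))\<^sup>2)"
      by (simp add: sum_distrib_left power_mult_distrib)
    also have "\<dots> \<le> (\<Sum>n\<in>F. (cmod (cinner h (\<Phi> n)))\<^sup>2)"
      using assms by (intro sum_mono power_mono) auto
    also have "\<dots> \<le> B * (norm h)\<^sup>2"
      by (rule B[OF that])
    finally show ?thesis
      using assms(2) by (simp add: field_simps)
  qed
  then show ?thesis by (rule BesselI)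
qed

text \<open>Testing the inequality at \<open>h = \<Phi> n\<close> and keeping only the term
  \<open>n\<close> bounds the fourth power of \<open>norm (\<Phi> n)\<close> by \<open>B\<close>
  times its square.\<close>

lemma Bessel_bounded:
  assumes "Bessel \<Phi>"
  shows "bounded (range (\<lambda>n. norm (\<Phi> n)))"
proof -
  obtain B where B: "B > 0"
    "\<And>F h. finite F \<Longrightarrow> (\<Sum>n\<in>F. (cmod (cinner h (\<Phi> n)))\<^sup>2) \<le> B * (norm h)\<^sup>2"
    using BesselE[OF assms] by metis
  have "norm (\<Phi> n) \<le> sqrt B" for n
  proof (cases "\<Phi> n = 0")
    case False
    have "cmod (cinner (\<Phi> n) (\<Phi> n)) = (norm (\<Phi> n))\<^sup>2"
      unfolding cinner_self norm_of_real by simp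
    then have "(norm (\<Phi> n))\<^sup>2 * (norm (\<Phi> n))\<^sup>2 \<le> B * (norm (\<Phi> n))\<^sup>2"
      using B(2)[of "{n}" "\<Phi> n"] by (simp only: sum.insert sum.empty finite.intros empty_iff power2_eq_square) simp
    then have "(norm (\<Phi> n))\<^sup>2 \<le> B"
      using False by (simp only: mult_le_cancel_right) (simp add: not_less)
    then show ?thesis
      by (rule real_le_rsqrt)
  qed (use B in simp)
  then show ?thesis
    by (auto simp: bounded_iff)
qed

text \<open>The coefficient of \<open>h\<close> against the weighted vector has as modulus the norm
  of the multiplier term at \<open>h\<close>, so the estimate for sums of norm squares applies with
  \<open>C * norm h\<close> bounding all subset sums.\<close>

lemma Bessel_of_multiplier_sums_le:
  assumes "\<And>F f. finite F \<Longrightarrow> norm (\<Sum>n\<in>F. multiplier_term m \<Phi> \<Psi> f n) \<le> C * norm f"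
  shows "Bessel (\<lambda>n. (cmod (m n) * norm (\<Phi> n)) *\<^sub>R \<Psi> n)"
proof (rule BesselI)
  fix F :: "nat set" and h
  assume F: "finite F"
  have "cmod (cinner h ((cmod (m n) * norm (\<Phi> n)) *\<^sub>R \<Psi> n)) = norm (multiplier_term m \<Phi> \<Psi> h n)" for n
    by (simp add: multiplier_term_def cinner_scaleR_right norm_scaleC norm_mult del: of_real_mult)
  moreover have "(\<Sum>n\<in>F. (norm (multiplier_term m \<Phi> \<Psi> h n))\<^sup>2) \<le> (2 * (C * norm h))\<^sup>2"
    using F assms finite_subset by (intro sum_squares_le_of_subset_sums_le) blast+
  ultimately show "(\<Sum>n\<in>F. (cmod (cinner h ((cmod (m n) * norm (\<Phi> n)) *\<^sub>R \<Psi> n)))\<^sup>2)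
      \<le> (2 * C)\<^sup>2 * (norm h)\<^sup>2"
    by (simp add: power_mult_distrib)
qed

section \<open>Consequences of lower norm bounds\<close>

lemma NBB_iff: "NBB \<Phi> \<longleftrightarrow> (\<exists>a>0. \<forall>n. a \<le> norm (\<Phi> n))"
proof
  assume "NBB \<Phi>"
  moreover have "(INF n. norm (\<Phi> n)) \<le> norm (\<Phi> n)" for n
    by (intro cINF_lower bdd_belowI2[where m = 0]) auto
  ultimately show "\<exists>a>0. \<forall>n. a \<le> norm (\<Phi> n)"
    unfolding NBB_def by blast
next
  assume "\<exists>a>0. \<forall>n. a \<le> norm (\<Phi> n)"
  then show "NBB \<Phi>"
    unfolding NBB_def by (metis UNIV_not_empty cINF_greatest less_le_trans)
qed

text \<open>The weighted coefficient is a product of three factors; bounding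
  \<open>norm (\<Phi> n)\<close>, or its product with \<open>cmod (m n)\<close>, from below leaves
  the coefficient of the desired sequence. With \<open>\<Phi>\<close> and \<open>\<Psi>\<close>
  exchanged this serves both (ii) and (iii).\<close>

lemma Bessel_of_NBB:
  assumes "Bessel (\<lambda>n. (cmod (m n) * norm (\<Phi> n)) *\<^sub>R \<Psi> n)"
  shows "NBB \<Phi> \<Longrightarrow> Bessel (\<lambda>n. m n *\<^sub>C \<Psi> n)"
    and "NBB (\<lambda>n. m n *\<^sub>C \<Phi> n) \<Longrightarrow> Bessel \<Psi>"
proof -
  have eq: "cmod (cinner h ((cmod (m n) * norm (\<Phi> n)) *\<^sub>R \<Psi> n))
      = norm (\<Phi> n) * (cmod (m n) * cmod (cinner h (\<Psi> n)))" for h n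
    by (simp add: cinner_scaleR_right norm_mult)
  show "Bessel (\<lambda>n. m n *\<^sub>C \<Psi> n)" if NBB: "NBB \<Phi>"
  proof -
    obtain a where a: "a > 0" "\<And>n. a \<le> norm (\<Phi> n)"
      using NBB unfolding NBB_iff by blast
    show ?thesis
      by (rule Bessel_mono[OF assms a(1)], unfold eq cinner_scaleC_right norm_mult complex_mod_cnj)
        (intro mult_right_mono a mult_nonneg_nonneg norm_ge_zero)
  qed
  show "Bessel \<Psi>" if NBB: "NBB (\<lambda>n. m n *\<^sub>C \<Phi> n)"
  proof -
    obtain a where a: "a > 0" "\<And>n. a \<le> norm (m n *\<^sub>C \<Phi> n)"
      using NBB unfolding NBB_iff by blast
    show ?thesis
    proof (rule Bessel_mono[OF assms a(1)])
      fix h n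
      show "a * cmod (cinner h (\<Psi> n)) \<le> cmod (cinner h ((cmod (m n) * norm (\<Phi> n)) *\<^sub>R \<Psi> n))"
        using mult_right_mono[OF a(2)[of n], of "cmod (cinner h (\<Psi> n))"]
        unfolding eq norm_scaleC by (simp add: mult_ac)
    qed
  qed
qed

lemma Bessel_of_scaleC_NBB:
  assumes "Bessel (\<lambda>n. m n *\<^sub>C \<Psi> n)" "NBB m"
  shows "Bessel \<Psi>"
proof -
  obtain a where a: "a > 0" "\<And>n. a \<le> cmod (m n)"
    using assms(2) unfolding NBB_iff by blast
  show ?thesis
    by (rule Bessel_mono[OF assms(1) a(1)], unfold cinner_scaleC_right norm_mult complex_mod_cnj)
      (intro mult_right_mono a norm_ge_zero)
qed

theorem lemma3p5:
  fixes \<Phi> \<Psi> :: "nat \<Rightarrow> 'a :: complex_hilbert" and m :: "nat \<Rightarrow> complex"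
  assumes separable: "separable_space (euclidean :: 'a topology)"
    and infinite_dim: "\<nexists>S :: 'a set. finite S \<and> complex_vector.span S = UNIV"
    and uncond: "multiplier_uncond_convergent m \<Phi> \<Psi>"
  shows
    "(Bessel (\<lambda>n. (cmod (m n) * norm (\<Phi> n)) *\<^sub>R \<Psi> n) \<and>
      Bessel (\<lambda>n. (cmod (m n) * norm (\<Psi> n)) *\<^sub>R \<Phi> n) \<and>
      bounded (range (\<lambda>n. cmod (m n) * norm (\<Phi> n) * norm (\<Psi> n)))) \<and>
     ((NBB \<Phi> \<longrightarrow> Bessel (\<lambda>n. m n *\<^sub>C \<Psi> n)) \<and>
      (NBB (\<lambda>n. m n *\<^sub>C \<Phi> n) \<longrightarrow> Bessel \<Psi>)) \<and>
     ((NBB \<Psi> \<longrightarrow> Bessel (\<lambda>n. m n *\<^sub>C \<Phi> n)) \<and>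
      (NBB (\<lambda>n. m n *\<^sub>C \<Psi> n) \<longrightarrow> Bessel \<Phi>)) \<and>
     (NBB \<Phi> \<and> NBB \<Psi> \<longrightarrow> bounded (range m)) \<and>
     (NBB \<Phi> \<and> NBB \<Psi> \<and> NBB m \<longrightarrow> SN m \<and> Bessel \<Phi> \<and> Bessel \<Psi>)"
proof -
  have "\<exists>C. \<forall>F\<in>Collect finite. norm (\<Sum>n\<in>F. multiplier_term m \<Phi> \<Psi> f n) \<le> C" for f
    using uncond unconditionally_convergent_bounded_sums
    unfolding multiplier_uncond_convergent_def by blast
  then obtain C where C:
    "\<And>F f. finite F \<Longrightarrow> norm (\<Sum>n\<in>F. multiplier_term m \<Phi> \<Psi> f n) \<le> C * norm f"
    using Banach_Steinhaus[of "Collect finite" "\<lambda>F f. \<Sum>n\<in>F. multiplier_term m \<Phi> \<Psi> f n"]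
      bounded_linear_multiplier_sum by blast
  have \<Psi>: "Bessel (\<lambda>n. (cmod (m n) * norm (\<Phi> n)) *\<^sub>R \<Psi> n)"
    using C by (rule Bessel_of_multiplier_sums_le)
  \<comment> \<open>The adjoint subsums obey the same bound \<open>C\<close>, and conjugating
    \<open>m\<close> leaves the weights unchanged.\<close>
  have "Bessel (\<lambda>n. (cmod (cnj (m n)) * norm (\<Psi> n)) *\<^sub>R \<Phi> n)"
    using C by (intro Bessel_of_multiplier_sums_le norm_adjoint_multiplier_sum_le)
  then have \<Phi>: "Bessel (\<lambda>n. (cmod (m n) * norm (\<Psi> n)) *\<^sub>R \<Phi> n)"
    by simp
  \<comment> \<open>The weighted vectors of the first Bessel sequence have exactly these products as
    norms.\<close>
  have bdd: "bounded (range (\<lambda>n. cmod (m n) * norm (\<Phi> n) * norm (\<Psi> n)))"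
    using Bessel_bounded[OF \<Psi>] by simp
  \<comment> \<open>By (ii) the vectors \<open>m n *\<^sub>C \<Psi> n\<close> form a Bessel
    sequence, so their norms are bounded by some \<open>K\<close>; dividing by a lower bound
    \<open>a\<close> for the norms of \<open>\<Psi>\<close> bounds \<open>m\<close>.\<close>
  have m_bdd: "bounded (range m)" if NBB: "NBB \<Phi>" "NBB \<Psi>"
  proof -
    have "bounded (range (\<lambda>n. norm (m n *\<^sub>C \<Psi> n)))"
      using Bessel_of_NBB(1)[OF \<Psi> NBB(1)] by (rule Bessel_bounded)
    then obtain K where K: "\<And>n. cmod (m n) * norm (\<Psi> n) \<le> K"
      by (auto simp: bounded_iff norm_scaleC)
    obtain a where a: "a > 0" "\<And>n. a \<le> norm (\<Psi> n)"
      using NBB(2) unfolding NBB_iff by blast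
    have "cmod (m n) \<le> K / a" for n
      using order_trans[OF mult_left_mono[OF a(2)[of n], of "cmod (m n)"] K[of n]] a(1)
      by (simp add: field_simps)
    then show ?thesis
      by (auto simp: bounded_iff)
  qed
  have "SN m" if "NBB \<Phi>" "NBB \<Psi>" "NBB m"
    using m_bdd[OF that(1,2)] that(3) unfolding SN_def NBB_iff bounded_iff by blast
  then show ?thesis
    using \<Phi> \<Psi> bdd m_bdd Bessel_of_NBB[OF \<Phi>] Bessel_of_NBB[OF \<Psi>] Bessel_of_scaleC_NBB
    by blast
qed

end
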